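(* If $n$ is a positive integer, then $$\sum_{k=0}^\infty \frac{\left(\frac12\right)_k^2}{k!^2}\,\frac{\binom{2k+2n}{2n}}{\binom{k+n}{n}^2}\,\frac{1}{2k+n}=\frac{1}{2n}\,\frac{n!}{\left(\frac12\right)_n}\left(-\frac{8}{(2n-1)(2n-3)}+\bigl((-1)^n+1\bigr)\pi+4\sum_{k=1}^{n-2}\frac{1}{4k+3-2n}\right)\frac1\pi,$$ where for $n=1$ the sum $\sum_{k=1}^{-1}\frac{1}{4k+3-2n}$ is interpreted as $-1$ (that is, $\sum_{k=1}^{-1}a_k=-a_0$), and for $n=2$ it is $0$. In particular, $$\sum_{k=0}^\infty \frac{\left(\frac12\right)_k^2}{k!^2\,(k+1)}=\frac4\pi,\qquad\text{equivalently}\qquad \sum_{k=0}^\infty\frac{\binom{2k}{k}C_k}{2^{4k}}=\frac4\pi,$$ $$\sum_{k=0}^\infty \frac{C_k^2}{2^{4k}}\,\frac{(2k+1)(2k+3)}{k+2}=-\frac{16}{3\pi}+4,$$ and $$\sum_{k=0}^\infty \frac{\left(\frac12\right)_k^2}{k!^2}\,\frac{(2k+1)(2k+5)}{(k+1)(k+2)(k+3)}=\frac{208}{45\pi}.$$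
   Context: $(x)_n=\prod_{j=0}^{n-1}(x+j)$ is the Pochhammer symbol. $C_k=\frac{1}{k+1}\binom{2k}{k}$ is the $k$-th Catalan number. *)

theory Defs
  imports "HOL-Analysis.Analysis"
begin

definition catalan :: "nat \<Rightarrow> real" where
  "catalan k = 1 / (real k + 1) * real ((2 * k) choose k)"

(* Sum over k = a, ..., b with integer bounds that is not cut off at 0 for b < a - 1: it satisfies
   osum f a c = osum f a b + osum f (b + 1) c for all a, b, c. In particular
   osum f 1 0 = 0 and osum f 1 (-1) = - f 0. *)
definition osum :: "(int \<Rightarrow> real) \<Rightarrow> int \<Rightarrow> int \<Rightarrow> real" where
  "osum f a b = (if a \<le> b + 1 then (\<Sum>k=a..b. f k) else - (\<Sum>k=b+1..a-1. f k))"

lemma osum_1_minus_1: "osum f 1 (-1) = - f 0"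
  by (simp add: osum_def)

lemma osum_1_0: "osum f 1 0 = 0"
  by (simp add: osum_def)

end

theory Submission
  imports Defs "HOL-Real_Asymp.Real_Asymp"
begin

text \<open>
  Put \<open>c\<^sub>k = (1/2)\<^sub>k / k! = binomial (2 k) k / 4\<^sup>k\<close>. Writing every binomial coefficient through \<open>c\<close>
  turns the \<open>k\<close>-th summand into \<open>n! / (1/2)\<^sub>n * c\<^sub>k * c\<^sub>k\<^sub>+\<^sub>n / (2 k + n)\<close>, so the task is to
  evaluate \<open>V\<^sub>n = \<Sum>\<^sub>k n / (2 k + n) * c\<^sub>k * c\<^sub>k\<^sub>+\<^sub>n\<close>. The closed form also becomes more regular:
  since \<open>- 8 / ((2n-1)(2n-3)) = 4 / (2n-1) - 4 / (2n-3)\<close>, the rational part supplies exactly the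
  two end terms \<open>k = 0\<close> and \<open>k = n - 1\<close> that the sum from \<open>1\<close> to \<open>n - 2\<close> lacks, and what has to be
  shown is

    \<open>2 \<pi> V\<^sub>n = ((-1)\<^sup>n + 1) \<pi> + 4 \<Sum>\<^sub>k\<^sub><\<^sub>n 1 / (4 k + 3 - 2 n)\<close>.

  The right-hand side is governed by a recursion of step \<open>2\<close>: passing from \<open>n\<close> to \<open>n + 2\<close> adds one
  term at each end of the arithmetic progression \<open>3 - 2 n, 7 - 2 n, ..., 2 n - 1\<close> of denominators,
  which changes it by \<open>- 8 / ((2n+1)(2n+3))\<close>.

  The left-hand side satisfies the same recursion by creative telescoping: there is a rational
  function \<open>R\<close> of \<open>n\<close> and \<open>k\<close> such that the summand of \<open>V\<^sub>n\<^sub>+\<^sub>2\<close> minus that of \<open>V\<^sub>n\<close> equals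
  \<open>G\<^sub>k\<^sub>+\<^sub>1 - G\<^sub>k\<close> with \<open>G\<^sub>k = R c\<^sub>k c\<^sub>k\<^sub>+\<^sub>n\<close> (\<open>certificate_identity\<close>, \<open>central_sum_step\<close>). Here
  \<open>G\<^sub>0 = 0\<close>, and \<open>R\<close> grows like \<open>- 4 k / ((2n+1)(2n+3))\<close>, so the limit of \<open>G\<close> follows from
  \<open>k c\<^sub>k c\<^sub>k\<^sub>+\<^sub>n \<longlonglongrightarrow> 1 / \<pi>\<close>, which is Wallis' product (\<open>central_product_limit\<close>). The initial values
  \<open>V\<^sub>1\<close> and \<open>V\<^sub>2\<close> telescope by themselves. The special series are multiples of \<open>V\<^sub>1\<close>, \<open>V\<^sub>2\<close> and \<open>V\<^sub>3\<close>.
\<close>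

section \<open>Normalised central binomial coefficients\<close>

text \<open>These are the Taylor coefficients of \<open>1 / sqrt (1 - x)\<close>.\<close>

definition central :: "nat \<Rightarrow> real" where
  "central k = pochhammer (1/2) k / fact k"

lemma central_0 [simp]: "central 0 = 1"
  by (simp add: central_def)

lemma central_Suc: "central (Suc k) = central k * ((2 * real k + 1) / (2 * real k + 2))"
  by (simp add: central_def pochhammer_Suc field_simps)

lemma central_binomial: "real ((2*k) choose k) = 4 ^ k * central k"
proof -
  have "real ((2*k) choose k) = fact (2*k) / (fact k * fact k)"
    by (simp add: binomial_fact mult_2)
  also have "\<dots> = 4 ^ k * central k"
    unfolding fact_double central_def by (simp add: power_mult)
  finally show ?thesis .
qed

lemma central_square_binomial: "(real ((2*k) choose k))\<^sup>2 / 2 ^ (4*k) = (central k)\<^sup>2"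
proof -
  have "(2::real) ^ (4*k) = (4 ^ k)\<^sup>2"
    by (simp add: power_mult power2_eq_square flip: power_mult_distrib)
  then show ?thesis
    by (simp add: central_binomial power_mult_distrib)
qed

text \<open>
  The factor of index \<open>j\<close> of the Wallis product is \<open>(2j)\<^sup>2 / ((2j-1)(2j+1))\<close>, which is exactly the
  factor by which \<open>(2 k + 1) c\<^sub>k\<^sup>2\<close> decreases when \<open>k\<close> goes from \<open>j - 1\<close> to \<open>j\<close>. This finite
  identity is what brings \<open>\<pi>\<close> into all the sums below.
\<close>

lemma central_wallis_product:
  "(2 * real k + 1) * (central k)\<^sup>2 * (\<Prod>j=1..k. 4 * real j ^ 2 / (4 * real j ^ 2 - 1)) = 1"
proof (induction k)
  case 0
  then show ?case by simp
next
  case (Suc k)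
  have nz: "4 * (real k + 1)\<^sup>2 - 1 = (2 * real k + 1) * (2 * real k + 3)"
    by (simp add: power2_eq_square algebra_simps)
  let ?f = "\<lambda>j. 4 * real j ^ 2 / (4 * real j ^ 2 - 1)"
  have "(2 * real (Suc k) + 1) * (central (Suc k))\<^sup>2 * ?f (Suc k) = (2 * real k + 1) * (central k)\<^sup>2"
    unfolding of_nat_Suc add.commute[of 1] nz central_Suc
    by (simp add: divide_simps) (simp add: power2_eq_square algebra_simps)
  then have "(2 * real (Suc k) + 1) * (central (Suc k))\<^sup>2 * (\<Prod>j=1..Suc k. ?f j)
      = (2 * real k + 1) * (central k)\<^sup>2 * (\<Prod>j=1..k. ?f j)"
    by (subst prod.nat_ivl_Suc') (simp_all only: le_add2 Suc_eq_plus1 flip: mult.assoc)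
  with Suc.IH show ?case
    by (simp only:)
qed

lemma central_square_limit: "(\<lambda>k. real k * (central k)\<^sup>2) \<longlonglongrightarrow> 1 / pi"
proof -
  let ?P = "\<lambda>k. \<Prod>j=1..k. 4 * real j ^ 2 / (4 * real j ^ 2 - 1)"
  have "(\<lambda>k. real k / (2 * real k + 1) * inverse (?P k)) \<longlonglongrightarrow> 1/2 * inverse (pi / 2)"
    by (intro tendsto_mult tendsto_inverse wallis) (real_asymp, simp)
  moreover have "real k / (2 * real k + 1) * inverse (?P k) = real k * (central k)\<^sup>2" for k
  proof -
    have "inverse (?P k) = (2 * real k + 1) * (central k)\<^sup>2"
      by (rule inverse_unique, subst mult.commute) (rule central_wallis_product)
    then show ?thesis by simp
  qed
  ultimately show ?thesis by (simp add: field_simps)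
qed

text \<open>
  Shifting one index leaves the limit alone because the ratio of consecutive coefficients
  tends to \<open>1\<close>.
\<close>

lemma central_product_limit: "(\<lambda>k. real k * (central k * central (k + n))) \<longlonglongrightarrow> 1 / pi"
proof (induction n)
  case 0
  then show ?case using central_square_limit by (simp add: power2_eq_square)
next
  case (Suc n)
  have "(\<lambda>k. (2 * (real k + real n) + 1) / (2 * (real k + real n) + 2)) \<longlonglongrightarrow> 1"
    by real_asymp
  from tendsto_mult[OF Suc this] show ?case
    by (simp add: central_Suc mult.assoc)
qed

section \<open>The recursion in the shift\<close>

text \<open>
  The telescoping relation after division by \<open>c\<^sub>k c\<^sub>k\<^sub>+\<^sub>n\<close>, with \<open>x\<close> for \<open>k\<close> and \<open>y\<close> for \<open>n\<close>; the
  certificate is \<open>R = - q x * x / d\<close>. Its shape is forced: the denominators \<open>2 x + y\<close> and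
  \<open>x + y + 1\<close> are those needed to match the poles of the two summands, the factor \<open>x\<close> cancels
  the denominator \<open>2 x + 2\<close> after the shift, and linear growth leaves a quadratic \<open>p\<close>, whose
  coefficients come from comparing coefficients of the powers of \<open>x\<close>.
\<close>

lemma certificate_identity:
  fixes x y :: real
  assumes "x \<ge> 0" "y > 0"
  defines "p \<equiv> \<lambda>x. 8 * x\<^sup>2 + (8 * y ^ 2 + 32 * y + 16) * x
                      + (8 * y ^ 3 + 30 * y ^ 2 + 27 * y + 6)"
  defines "q \<equiv> \<lambda>x. p x / ((2 * x + y) * (x + y + 1))"
  defines "d \<equiv> (2 * y + 1) * (2 * y + 3)"
  shows "y / (2 * x + y) + (q x / d * x - q (x + 1) / d * (x + 1)
              * ((2 * x + 1) / (2 * x + 2) * ((2 * (x + y) + 1) / (2 * (x + y) + 2))))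
      = (y + 2) / (2 * x + (y + 2))
         * ((2 * (x + y) + 1) / (2 * (x + y) + 2) * ((2 * (x + y + 1) + 1) / (2 * (x + y + 1) + 2)))"
proof -
  (* Clearing denominators is done with the linear factors kept opaque, so that only the
     polynomial identity is ever expanded. *)
  have clear: "y / D1 + (P / (D1 * E1) / d * x - P' / (D2 * E2) / d * z * (U / (2 * z) * (V / (2 * E1))))
      = w / D2 * (V / (2 * E1) * (W / (2 * E2)))"
    if "4 * y * d * D2 * E1 * E2 + 4 * x * P * D2 * E2 - P' * D1 * U * V = w * d * D1 * V * W"
      and "D1 > 0" "D2 > 0" "E1 > 0" "E2 > 0" "d > 0" "z > 0"
    for D1 D2 E1 E2 P P' U V W w z d :: real
  proof -
    let ?M = "4 * d * D1 * D2 * E1 * E2"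
    have "y / D1 + (P / (D1 * E1) / d * x - P' / (D2 * E2) / d * z * (U / (2 * z) * (V / (2 * E1))))
        = (4 * y * d * D2 * E1 * E2 + 4 * x * P * D2 * E2 - P' * D1 * U * V) / ?M"
      using that(2-) by (simp add: add_divide_distrib diff_divide_distrib ac_simps)
    also have "\<dots> = w / D2 * (V / (2 * E1) * (W / (2 * E2)))"
      unfolding that(1) using that(2-) by simp
    finally show ?thesis .
  qed
  have poly: "4 * y * d * (2 * x + y + 2) * (x + y + 1) * (x + y + 2)
        + 4 * x * p x * (2 * x + y + 2) * (x + y + 2)
        - p (x + 1) * (2 * x + y) * (2 * x + 1) * (2 * (x + y) + 1)
      = (y + 2) * d * (2 * x + y) * (2 * (x + y) + 1) * (2 * (x + y + 1) + 1)"
    unfolding p_def d_def by algebra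
  have e: "2 * (x + 1) + y = 2 * x + y + 2" "x + 1 + y + 1 = x + y + 2" "2 * x + 2 = 2 * (x + 1)"
    "2 * (x + y) + 2 = 2 * (x + y + 1)" "2 * x + (y + 2) = 2 * x + y + 2"
    "2 * (x + y + 1) + 2 = 2 * (x + y + 2)"
    by simp_all
  have "d > 0" using assms(1,2) by (simp add: d_def)
  then show ?thesis
    unfolding q_def e by (intro clear[OF poly]) (use assms(1,2) in auto)
qed

text \<open>
  The assumption \<open>n > 0\<close> is essential: for \<open>n = 0\<close> the factor \<open>k\<close> in \<open>R\<close> cancels against
  \<open>2 k + n\<close>, and \<open>G\<close> no longer vanishes at \<open>k = 0\<close>.
\<close>

lemma central_sum_step:
  fixes n :: nat
  assumes "n > 0"
    and S: "(\<lambda>k. real n / (2 * real k + real n) * (central k * central (k + n))) sums S"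
  shows "(\<lambda>k. real (n + 2) / (2 * real k + real (n + 2)) * (central k * central (k + (n + 2))))
           sums (S - 4 / (pi * (2 * real n + 1) * (2 * real n + 3)))"
proof -
  define d where "d = (2 * real n + 1) * (2 * real n + 3)"
  define p where "p x = 8 * x\<^sup>2 + (8 * real n ^ 2 + 32 * real n + 16) * x
                        + (8 * real n ^ 3 + 30 * real n ^ 2 + 27 * real n + 6)" for x
  define q where "q x = p x / ((2 * x + real n) * (x + real n + 1))" for x
  define G where "G k = - (q (real k) / d) * (real k * (central k * central (k + n)))" for k
  have "d > 0" by (simp add: d_def add_pos_nonneg)
  have "(\<lambda>k. q (real k)) \<longlonglongrightarrow> 4"
    unfolding q_def p_def by real_asymp
  then have "G \<longlonglongrightarrow> - (4 / d) * (1 / pi)"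
    unfolding G_def by (intro tendsto_intros central_product_limit) (use \<open>d > 0\<close> in auto)
  from telescope_sums[OF this] have tele: "(\<lambda>k. G (Suc k) - G k) sums (- 4 / (pi * d))"
    by (simp add: G_def mult.commute)
  have cert: "real n / (2 * real k + real n) * (central k * central (k + n)) + (G (Suc k) - G k)
      = real (n + 2) / (2 * real k + real (n + 2)) * (central k * central (k + (n + 2)))" for k
  proof -
    define x y where "x = real k" and "y = real n"
    have pos: "x \<ge> 0" "y > 0" using assms by (auto simp: x_def y_def)
    have "y / (2 * x + y) + (q x / d * x - q (x + 1) / d * (x + 1)
              * ((2 * x + 1) / (2 * x + 2) * ((2 * (x + y) + 1) / (2 * (x + y) + 2))))
      = (y + 2) / (2 * x + (y + 2))
         * ((2 * (x + y) + 1) / (2 * (x + y) + 2) * ((2 * (x + y + 1) + 1) / (2 * (x + y + 1) + 2)))"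
      unfolding q_def d_def p_def y_def[symmetric] using certificate_identity[OF pos] .
    note identity = this
    define A where "A = central k * central (k + n)"
    have G: "G k = - (q x / d * x) * A"
      by (simp add: G_def A_def x_def)
    have G_Suc: "G (Suc k) = - (q (x + 1) / d * (x + 1)
              * ((2 * x + 1) / (2 * x + 2) * ((2 * (x + y) + 1) / (2 * (x + y) + 2)))) * A"
      unfolding G_def A_def by (simp add: central_Suc x_def y_def ac_simps)
    have new: "central k * central (k + (n + 2)) = ((2 * (x + y) + 1) / (2 * (x + y) + 2)
                      * ((2 * (x + y + 1) + 1) / (2 * (x + y + 1) + 2))) * A"
      by (simp add: A_def central_Suc x_def y_def ac_simps)
    have collect: "u * A + (- t * A - - s * A) = (u + (s - t)) * A" for u s t :: real
      by (simp add: algebra_simps)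
    show ?thesis
      unfolding new G G_Suc unfolding A_def[symmetric] x_def[symmetric] y_def[symmetric] of_nat_add
        collect identity by (simp add: mult.assoc)
  qed
  from sums_add[OF S tele] show ?thesis
    unfolding cert by (simp add: d_def mult.assoc)
qed

section \<open>Initial values and closed form\<close>

text \<open>
  The summand is \<open>c\<^sub>k\<^sup>2 / (2 (k + 1))\<close>, and it is the difference of consecutive terms of
  \<open>2 k c\<^sub>k\<^sup>2\<close>.
\<close>

lemma central_sum_1: "(\<lambda>k. 1 / (2 * real k + 1) * (central k * central (k + 1))) sums (2 / pi)"
proof -
  have "(\<lambda>k. 2 * (real k * (central k)\<^sup>2)) \<longlonglongrightarrow> 2 * (1 / pi)"
    by (intro tendsto_intros central_square_limit)
  from telescope_sums[OF this]
  have "(\<lambda>k. 2 * (real (Suc k) * (central (Suc k))\<^sup>2) - 2 * (real k * (central k)\<^sup>2)) sums (2 / pi)"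
    by simp
  moreover have "2 * (real (Suc k) * (central (Suc k))\<^sup>2) - 2 * (real k * (central k)\<^sup>2)
      = 1 / (2 * real k + 1) * (central k * central (k + 1))" for k
    by (simp add: central_Suc divide_simps) (simp add: power2_eq_square algebra_simps)
  ultimately show ?thesis by simp
qed

text \<open>
  The antidifference is the certificate of \<open>central_sum_step\<close> at \<open>n = 0\<close>, with \<open>k\<close> cancelled.
  It starts at \<open>G\<^sub>0 = - 1\<close>, which produces the rational part of the value.
\<close>

lemma central_sum_2:
  "(\<lambda>k. 2 / (2 * real k + 2) * (central k * central (k + 2))) sums (1 - 4 / (3 * pi))"
proof -
  define G where "G k = - ((2 * real k + 1) * (2 * real k + 3) / (3 * (real k + 1))) * (central k)\<^sup>2" for k
  have "(\<lambda>k. - ((2 * real k + 1) * (2 * real k + 3) / (3 * (real k + 1) * real k))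
            * (real k * (central k)\<^sup>2)) \<longlonglongrightarrow> - (4 / 3) * (1 / pi)"
    by (intro tendsto_mult central_square_limit) real_asymp
  moreover have "eventually (\<lambda>k. - ((2 * real k + 1) * (2 * real k + 3) / (3 * (real k + 1) * real k))
            * (real k * (central k)\<^sup>2) = G k) sequentially"
    using eventually_gt_at_top[of 0] by eventually_elim (simp add: G_def)
  ultimately have "G \<longlonglongrightarrow> - (4 / 3) * (1 / pi)"
    by (rule Lim_transform_eventually)
  from telescope_sums[OF this] have "(\<lambda>k. G (Suc k) - G k) sums (1 - 4 / (3 * pi))"
    by (simp add: G_def)
  moreover have "G (Suc k) - G k = 2 / (2 * real k + 2) * (central k * central (k + 2))" for k
    by (simp add: G_def central_Suc divide_simps) (simp add: power2_eq_square algebra_simps)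
  ultimately show ?thesis by simp
qed

text \<open>
  The denominators \<open>3 - 2 n, 7 - 2 n, ..., 2 n - 1\<close> are odd, hence never zero.
\<close>

definition odd_reciprocal_sum :: "nat \<Rightarrow> real" where
  "odd_reciprocal_sum n = (\<Sum>k<n. 1 / (4 * real k + 3 - 2 * real n))"

lemma odd_reciprocal_sum_step:
  "odd_reciprocal_sum (n + 2) = odd_reciprocal_sum n - 2 / ((2 * real n + 1) * (2 * real n + 3))"
proof -
  have shift: "4 * real k + 3 - 2 * real (n + 2) = 4 * real k - 1 - 2 * real n"
    "4 * real (Suc k) - 1 - 2 * real n = 4 * real k + 3 - 2 * real n" for k
    by simp_all
  (* The progression for n + 2 is that for n with -1 - 2 n put in front and 2 n + 3 at the end. *)
  have "odd_reciprocal_sum (n + 2) = (\<Sum>k<Suc (Suc n). 1 / (4 * real k - 1 - 2 * real n))"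
    unfolding odd_reciprocal_sum_def shift by simp
  also have "\<dots> = 1 / (- 1 - 2 * real n) + (\<Sum>k<Suc n. 1 / (4 * real (Suc k) - 1 - 2 * real n))"
    by (subst sum.lessThan_Suc_shift) simp
  also have "(\<Sum>k<Suc n. 1 / (4 * real (Suc k) - 1 - 2 * real n)) = odd_reciprocal_sum n + 1 / (4 * real n + 3 - 2 * real n)"
    unfolding odd_reciprocal_sum_def shift by simp
  also have "4 * real n + 3 - 2 * real n = 2 * real n + 3"
    by simp
  also have "1 / (- 1 - 2 * real n) = - (1 / (2 * real n + 1))"
    by (simp add: minus_divide_right)
  finally have "odd_reciprocal_sum (n + 2) = - (1 / (2 * real n + 1)) + (odd_reciprocal_sum n + 1 / (2 * real n + 3))" .
  moreover have "2 / ((2 * real n + 1) * (2 * real n + 3)) = 1 / (2 * real n + 1) - 1 / (2 * real n + 3)"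
    by (simp add: diff_frac_eq add_nonneg_eq_0_iff)
  ultimately show ?thesis by simp
qed

lemma central_sum:
  assumes "n > 0"
  shows "(\<lambda>k. real n / (2 * real k + real n) * (central k * central (k + n)))
           sums ((((-1) ^ n + 1) * pi + 4 * odd_reciprocal_sum n) / (2 * pi))"
  using assms
proof (induction n rule: induct_nat_012)
  case 0
  then show ?case by simp
next
  case 1
  show ?case using central_sum_1 by (simp add: odd_reciprocal_sum_def)
next
  case (ge2 n)
  show ?case
  proof (cases "n = 0")
    case True
    have "(((-1) ^ 2 + 1) * pi + 4 * odd_reciprocal_sum 2) / (2 * pi) = 1 - 4 / (3 * pi)"
      by (simp add: odd_reciprocal_sum_def numeral_2_eq_2 field_simps)
    then show ?thesis
      using central_sum_2 True by (simp add: numeral_2_eq_2 del: power_Suc)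
  next
    case False
    from central_sum_step[OF _ ge2.IH(1)] False
    have "(\<lambda>k. real (n + 2) / (2 * real k + real (n + 2)) * (central k * central (k + (n + 2))))
           sums ((((-1) ^ n + 1) * pi + 4 * odd_reciprocal_sum n) / (2 * pi)
             - 4 / (pi * (2 * real n + 1) * (2 * real n + 3)))" by simp
    also have "(((-1) ^ n + 1) * pi + 4 * odd_reciprocal_sum n) / (2 * pi)
             - 4 / (pi * (2 * real n + 1) * (2 * real n + 3))
        = (((-1) ^ (n + 2) + 1) * pi + 4 * odd_reciprocal_sum (n + 2)) / (2 * pi)"
    proof -
      have "(s * pi + 4 * A) / (2 * pi) - 4 / (pi * u * v) = (s * pi + 4 * (A - 2 / (u * v))) / (2 * pi)"
        if "u > 0" "v > 0" for s A u v :: real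
        using that by (simp add: field_simps)
      from this[of "2 * real n + 1" "2 * real n + 3"] show ?thesis
        unfolding odd_reciprocal_sum_step by simp
    qed
    finally show ?thesis by (simp only: add_2_eq_Suc')
  qed
qed

section \<open>Translation to the stated form\<close>

text \<open>
  The full sum over \<open>k < n\<close> consists of the terms \<open>1 / (3 - 2 n)\<close> at \<open>k = 0\<close> and \<open>1 / (2 n - 1)\<close> at
  \<open>k = n - 1\<close> and of those with \<open>1 \<le> k \<le> n - 2\<close>; the fraction with the two odd factors is,
  by partial fractions, \<open>4\<close> times the sum of the two outer terms. For \<open>n = 1\<close> the outer terms coincide, and the
  convention that the sum from \<open>1\<close> to \<open>-1\<close> is minus the term at \<open>0\<close> removes the duplicate.
\<close>

lemma odd_reciprocal_sum_conv_osum: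
  assumes "n > 0"
  shows "4 * odd_reciprocal_sum n = - (8 / ((2 * real n - 1) * (2 * real n - 3)))
           + 4 * osum (\<lambda>k. 1 / (4 * real_of_int k + 3 - 2 * real n)) 1 (int n - 2)"
proof -
  obtain m where n: "n = Suc m" using assms by (cases n) auto
  let ?f = "\<lambda>k. 1 / (4 * real_of_int k + 3 - 2 * real n)"
  have os: "osum ?f 1 (int n - 2) = (\<Sum>k<m. ?f (int k)) - ?f 0"
  proof (cases m)
    case 0
    then show ?thesis by (simp add: n osum_1_minus_1)
  next
    case (Suc l)
    have "osum ?f 1 (int n - 2) = (\<Sum>k=1..int l. ?f k)"
      by (simp add: osum_def n Suc)
    also have "\<dots> = (\<Sum>k<l. ?f (int (Suc k)))"
      by (rule sum.reindex_bij_witness[of _ "\<lambda>k. int (Suc k)" "\<lambda>k. nat (k - 1)"]) auto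
    also have "\<dots> = (\<Sum>k<m. ?f (int k)) - ?f 0"
      unfolding Suc by (subst sum.lessThan_Suc_shift) simp
    finally show ?thesis .
  qed
  have odd: "2 * real n - 3 \<noteq> 0" "2 * real n - 1 \<noteq> 0"
  proof -
    have "2 * n \<noteq> 3" "2 * n \<noteq> 1" by presburger+
    then have "real (2 * n) \<noteq> real 3" "real (2 * n) \<noteq> real 1" by (simp_all only: of_nat_eq_iff not_False_eq_True)
    then show "2 * real n - 3 \<noteq> 0" "2 * real n - 1 \<noteq> 0" by simp_all
  qed
  have "odd_reciprocal_sum n = (\<Sum>k<m. ?f (int k)) + 1 / (2 * real n - 1)"
    by (simp add: odd_reciprocal_sum_def n)
  moreover have "?f 0 = - (1 / (2 * real n - 3))" "2 / ((2 * real n - 1) * (2 * real n - 3)) = 1 / (2 * real n - 3) - 1 / (2 * real n - 1)"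
    using odd by (simp_all add: divide_simps)
  ultimately show ?thesis unfolding os by simp
qed

text \<open>
  All binomial coefficients reduce to \<open>c\<close> by the duplication formula
  \<open>(2 m)! = 4\<^sup>m (1/2)\<^sub>m m!\<close>; the powers of \<open>4\<close> cancel.
\<close>

lemma summand_conv_central:
  "(pochhammer (1/2 :: real) k)\<^sup>2 / (fact k)\<^sup>2
     * (real ((2*k + 2*n) choose (2*n)) / (real ((k + n) choose n))\<^sup>2)
   = fact n / pochhammer (1/2 :: real) n * (central k * central (k + n))"
proof -
  have p: "pochhammer (1/2 :: real) j \<noteq> 0" for j
    using pochhammer_pos[of "1/2 :: real" j] by simp
  have b1: "real ((2*k + 2*n) choose (2*n)) = fact (2*(k+n)) / (fact (2*n) * fact (2*k))"
    by (simp add: binomial_fact)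
  have b2: "real ((k + n) choose n) = fact (k+n) / (fact n * fact k)"
    by (simp add: binomial_fact)
  show ?thesis
    unfolding b1 b2 fact_double central_def using p
    by (simp add: divide_simps power_add power2_eq_square power_mult)
qed

theorem corollary17:
  shows "(\<forall>n::nat. n > 0 \<longrightarrow>
           (\<lambda>k::nat. (pochhammer (1/2 :: real) k)\<^sup>2 / (fact k)\<^sup>2
                 * (real ((2*k + 2*n) choose (2*n)) / (real ((k + n) choose n))\<^sup>2)
                 * (1 / (2 * real k + real n)))
           sums
           (1 / (2 * real n) * (fact n / pochhammer (1/2 :: real) n)
             * (- (8 / ((2 * real n - 1) * (2 * real n - 3)))
                + ((-1) ^ n + 1) * pi
                + 4 * osum (\<lambda>k. 1 / (4 * real_of_int k + 3 - 2 * real n)) 1 (int n - 2))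
             * (1 / pi)))
       \<and> (\<lambda>k::nat. (pochhammer (1/2 :: real) k)\<^sup>2 / ((fact k)\<^sup>2 * (real k + 1)))
           sums (4 / pi)
       \<and> (\<lambda>k::nat. real ((2*k) choose k) * catalan k / 2 ^ (4*k)) sums (4 / pi)
       \<and> (\<lambda>k::nat. (catalan k)\<^sup>2 / 2 ^ (4*k)
               * ((2 * real k + 1) * (2 * real k + 3) / (real k + 2)))
           sums (- (16 / (3 * pi)) + 4)
       \<and> (\<lambda>k::nat. (pochhammer (1/2 :: real) k)\<^sup>2 / (fact k)\<^sup>2
               * ((2 * real k + 1) * (2 * real k + 5)
                  / ((real k + 1) * (real k + 2) * (real k + 3))))
           sums (208 / (45 * pi))"
proof (intro conjI allI impI)
  fix n :: nat
  assume n: "n > 0"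
  define K where "K = fact n / pochhammer (1/2 :: real) n"
  from sums_mult[OF central_sum[OF n], of "K / real n"] n
  show "(\<lambda>k::nat. (pochhammer (1/2 :: real) k)\<^sup>2 / (fact k)\<^sup>2
                 * (real ((2*k + 2*n) choose (2*n)) / (real ((k + n) choose n))\<^sup>2)
                 * (1 / (2 * real k + real n)))
           sums
           (1 / (2 * real n) * (fact n / pochhammer (1/2 :: real) n)
             * (- (8 / ((2 * real n - 1) * (2 * real n - 3)))
                + ((-1) ^ n + 1) * pi
                + 4 * osum (\<lambda>k. 1 / (4 * real_of_int k + 3 - 2 * real n)) 1 (int n - 2))
             * (1 / pi))"
    unfolding summand_conv_central odd_reciprocal_sum_conv_osum[OF n] K_def[symmetric]
    by (simp add: field_simps)
next
  have t: "(pochhammer (1/2 :: real) k)\<^sup>2 / ((fact k)\<^sup>2 * (real k + 1))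
       = 2 * (1 / (2 * real k + 1) * (central k * central (k + 1)))" for k
    by (simp add: central_Suc divide_simps) (simp add: central_def field_simps power2_eq_square)
  show s: "(\<lambda>k::nat. (pochhammer (1/2 :: real) k)\<^sup>2 / ((fact k)\<^sup>2 * (real k + 1))) sums (4 / pi)"
    using sums_mult[OF central_sum_1, of 2] unfolding t by simp
  have "real ((2*k) choose k) * catalan k / 2 ^ (4*k)
       = (pochhammer (1/2 :: real) k)\<^sup>2 / ((fact k)\<^sup>2 * (real k + 1))" for k
  proof -
    have "real ((2*k) choose k) * catalan k / 2 ^ (4*k) = (real ((2*k) choose k))\<^sup>2 / 2 ^ (4*k) / (real k + 1)"
      by (simp add: catalan_def power2_eq_square)
    then show ?thesis
      by (simp add: central_square_binomial) (simp add: central_def power_divide)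
  qed
  with s show "(\<lambda>k::nat. real ((2*k) choose k) * catalan k / 2 ^ (4*k)) sums (4 / pi)"
    by simp
next
  have "(catalan k)\<^sup>2 / 2 ^ (4*k) * ((2 * real k + 1) * (2 * real k + 3) / (real k + 2))
     = 4 * (2 / (2 * real k + 2) * (central k * central (k + 2)))" for k
  proof -
    have "(catalan k)\<^sup>2 / 2 ^ (4*k) = (real ((2*k) choose k))\<^sup>2 / 2 ^ (4*k) / (real k + 1)\<^sup>2"
      by (simp add: catalan_def power_divide)
    then have "(catalan k)\<^sup>2 / 2 ^ (4*k) = (central k / (real k + 1))\<^sup>2"
      by (simp add: central_square_binomial power_divide)
    then show ?thesis
      by (simp only:) (simp add: central_Suc divide_simps, simp add: power2_eq_square algebra_simps)
  qed
  with sums_mult[OF central_sum_2, of 4]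
  show "(\<lambda>k::nat. (catalan k)\<^sup>2 / 2 ^ (4*k)
               * ((2 * real k + 1) * (2 * real k + 3) / (real k + 2)))
           sums (- (16 / (3 * pi)) + 4)"
    by simp
next
  have "(pochhammer (1/2 :: real) k)\<^sup>2 / (fact k)\<^sup>2
               * ((2 * real k + 1) * (2 * real k + 5)
                  / ((real k + 1) * (real k + 2) * (real k + 3)))
     = 8 / 3 * (real 3 / (2 * real k + real 3) * (central k * central (k + 3)))" for k
  proof -
    have "(pochhammer (1/2 :: real) k)\<^sup>2 / (fact k)\<^sup>2 = (central k)\<^sup>2"
      by (simp add: central_def power_divide)
    then show ?thesis
      by (simp add: central_Suc numeral_3_eq_3 divide_simps) (simp add: power2_eq_square algebra_simps)
  qed
  moreover have "8 / 3 * ((((-1) ^ 3 + 1) * pi + 4 * odd_reciprocal_sum 3) / (2 * pi)) = 208 / (45 * pi)"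
  proof -
    have "odd_reciprocal_sum 3 = 13 / 15"
      by (simp add: odd_reciprocal_sum_def numeral_3_eq_3)
    then show ?thesis by (simp only:) simp
  qed
  ultimately show "(\<lambda>k::nat. (pochhammer (1/2 :: real) k)\<^sup>2 / (fact k)\<^sup>2
               * ((2 * real k + 1) * (2 * real k + 5)
                  / ((real k + 1) * (real k + 2) * (real k + 3))))
           sums (208 / (45 * pi))"
    using sums_mult[OF central_sum[of 3], of "8 / 3"] by simp
qed

end
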